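(* Let $A, B, C, D, E, F, X, Y$ be $n \times n$ complex matrices with $$X^2 A + Y^2 B + XYC + XD + YE + F = 0 .$$ Suppose that $X$ and $Y$ have common left eigenvectors corresponding to all their eigenvalues (not necessarily the same eigenvalues for $X$ and $Y$). Then all the eigenvalues of $X$ and $Y$ are zeros of the bivariate determinantal polynomial $$\det\left(\alpha^2 A + \mu^2 B + \alpha\mu\, C + \alpha D + \mu E + F\right),$$ in the sense that for every eigenvalue $\alpha$ of $X$ and every corresponding eigenvalue $\mu$ of $Y$ one has $\det\left(\alpha^2 A + \mu^2 B + \alpha\mu\, C + \alpha D + \mu E + F\right) = 0$.
   Context: An eigenvalue $\alpha$ of $X$ and an eigenvalue $\mu$ of $Y$ are called corresponding if there is a nonzero row vector $g$ (a common left eigenvector) with $gX = \alpha g$ and $gY = \mu g$. "$X$ and $Y$ have common left eigenvectors corresponding to all their eigenvalues" means that every eigenvalue of $X$ has a corresponding eigenvalue of $Y$, and every eigenvalue of $Y$ has a corresponding eigenvalue of $X$. *)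

theory Defs
  imports Complex_Main "Jordan_Normal_Form.Char_Poly"
begin

(* Row vectors of length n are matrices in carrier_mat 1 n.  The library's eigenvalue is defined
   through column (right) eigenvectors; here a left eigenvector is required in addition. *)

definition corresponding_eigenvalues :: "complex mat \<Rightarrow> complex mat \<Rightarrow> complex \<Rightarrow> complex \<Rightarrow> bool" where
  "corresponding_eigenvalues X Y \<alpha> \<mu> \<longleftrightarrow>
     eigenvalue X \<alpha> \<and> eigenvalue Y \<mu> \<and>
     (\<exists>g \<in> carrier_mat 1 (dim_row X).
        g \<noteq> 0\<^sub>m 1 (dim_row X) \<and> g * X = \<alpha> \<cdot>\<^sub>m g \<and> g * Y = \<mu> \<cdot>\<^sub>m g)"

definition common_left_eigenvectors :: "complex mat \<Rightarrow> complex mat \<Rightarrow> bool" where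
  "common_left_eigenvectors X Y \<longleftrightarrow>
     (\<forall>\<alpha>. eigenvalue X \<alpha> \<longrightarrow> (\<exists>\<mu>. corresponding_eigenvalues X Y \<alpha> \<mu>)) \<and>
     (\<forall>\<mu>. eigenvalue Y \<mu> \<longrightarrow> (\<exists>\<alpha>. corresponding_eigenvalues X Y \<alpha> \<mu>))"

end

theory Submission
  imports Defs
begin

text \<open>
  A common left eigenvector \<open>g\<close> for \<open>\<alpha>\<close> and \<open>\<mu>\<close> sees \<open>X\<close> and \<open>Y\<close> only as the scalars \<open>\<alpha>\<close> and \<open>\<mu>\<close>,
  because in every term of the matrix equation they stand to the left of the coefficient.
  Multiplying the equation by \<open>g\<close> from the left hence replaces \<open>X\<close> by \<open>\<alpha>\<close> and \<open>Y\<close> by \<open>\<mu>\<close>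
  (lemmas \<open>left_eigenvector_mult\<close> and \<open>left_eigenvector_mult_mult\<close>), and so puts the nonzero
  row \<open>g\<close> into the left kernel of the evaluated polynomial, whose determinant must vanish
  (lemma \<open>det_zero_of_left_kernel\<close>).
\<close>

text \<open>
  Multiplying \<open>g * M = 0\<close> by the adjugate of \<open>M\<close> from the right gives \<open>det M \<cdot> g = 0\<close>, so a nonzero
  entry of \<open>g\<close> forces \<open>det M = 0\<close>.
\<close>

lemma det_zero_of_left_kernel:
  fixes M g :: "'a :: idom mat"
  assumes M: "M \<in> carrier_mat n n" and g: "g \<in> carrier_mat m n"
    and nz: "g \<noteq> 0\<^sub>m m n" and ker: "g * M = 0\<^sub>m m n"
  shows "det M = 0"
proof -
  have "det M \<cdot>\<^sub>m g = g * (det M \<cdot>\<^sub>m 1\<^sub>m n)"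
    using g by (simp add: mult_smult_distrib[OF g one_carrier_mat])
  also have "\<dots> = g * (M * adj_mat M)"
    using adj_mat(2)[OF M] by simp
  also have "\<dots> = g * M * adj_mat M"
    using assoc_mult_mat[OF g M adj_mat(1)[OF M]] by simp
  also have "\<dots> = 0\<^sub>m m n"
    using ker adj_mat(1)[OF M] by simp
  finally have z: "det M \<cdot>\<^sub>m g = 0\<^sub>m m n" .
  obtain i j where ij: "i < m" "j < n" "g $$ (i, j) \<noteq> 0"
    using nz g by (metis carrier_matD eq_matI index_zero_mat)
  have "det M * g $$ (i, j) = (det M \<cdot>\<^sub>m g) $$ (i, j)"
    using ij g by simp
  also have "\<dots> = 0"
    using ij by (simp add: z)
  finally show ?thesis
    using ij(3) by simp
qed

text \<open>
  The scalar is put on \<open>A\<close> rather than on \<open>g\<close>, so that after the replacement in each summand of a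
  matrix polynomial the factor \<open>g\<close> can be pulled out of the whole sum again.
\<close>

lemma left_eigenvector_mult:
  fixes g X A :: "'a :: comm_ring_1 mat"
  assumes g: "g \<in> carrier_mat m n" and X: "X \<in> carrier_mat n n" and A: "A \<in> carrier_mat n k"
    and eig: "g * X = \<alpha> \<cdot>\<^sub>m g"
  shows "g * (X * A) = g * (\<alpha> \<cdot>\<^sub>m A)"
proof -
  have "g * (X * A) = g * X * A"
    using assoc_mult_mat[OF g X A] by simp
  also have "\<dots> = g * (\<alpha> \<cdot>\<^sub>m A)"
    using mult_smult_assoc_mat[OF g A] mult_smult_distrib[OF g A] eig by simp
  finally show ?thesis .
qed

lemma left_eigenvector_mult_mult:
  fixes g X Y A :: "'a :: comm_ring_1 mat"
  assumes g: "g \<in> carrier_mat m n" and X: "X \<in> carrier_mat n n" and Y: "Y \<in> carrier_mat n n"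
    and A: "A \<in> carrier_mat n k"
    and eigX: "g * X = \<alpha> \<cdot>\<^sub>m g" and eigY: "g * Y = \<mu> \<cdot>\<^sub>m g"
  shows "g * (X * Y * A) = g * ((\<alpha> * \<mu>) \<cdot>\<^sub>m A)"
proof -
  have YA: "Y * A \<in> carrier_mat n k"
    using Y A by simp
  have "g * (X * Y * A) = g * (X * (Y * A))"
    using assoc_mult_mat[OF X Y A] by simp
  also have "\<dots> = \<alpha> \<cdot>\<^sub>m (g * (Y * A))"
    using left_eigenvector_mult[OF g X YA eigX] mult_smult_distrib[OF g YA] by simp
  also have "\<dots> = \<alpha> \<cdot>\<^sub>m (\<mu> \<cdot>\<^sub>m (g * A))"
    using left_eigenvector_mult[OF g Y A eigY] mult_smult_distrib[OF g A] by simp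
  also have "\<dots> = g * ((\<alpha> * \<mu>) \<cdot>\<^sub>m A)"
    using mult_smult_distrib[OF g A] by (auto simp: mult.assoc)
  finally show ?thesis .
qed

theorem lemma2:
  fixes n :: nat and A B C D E F X Y :: "complex mat"
  assumes "A \<in> carrier_mat n n" "B \<in> carrier_mat n n" "C \<in> carrier_mat n n"
    and "D \<in> carrier_mat n n" "E \<in> carrier_mat n n" "F \<in> carrier_mat n n"
    and "X \<in> carrier_mat n n" "Y \<in> carrier_mat n n"
    and "X ^\<^sub>m 2 * A + Y ^\<^sub>m 2 * B + X * Y * C + X * D + Y * E + F = 0\<^sub>m n n"
    and "common_left_eigenvectors X Y"
  shows "\<forall>\<alpha> \<mu>. eigenvalue X \<alpha> \<longrightarrow> corresponding_eigenvalues X Y \<alpha> \<mu> \<longrightarrow>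
           det (\<alpha>^2 \<cdot>\<^sub>m A + \<mu>^2 \<cdot>\<^sub>m B + (\<alpha> * \<mu>) \<cdot>\<^sub>m C + \<alpha> \<cdot>\<^sub>m D + \<mu> \<cdot>\<^sub>m E + F) = 0"
proof (intro allI impI)
  fix \<alpha> \<mu>
  assume "corresponding_eigenvalues X Y \<alpha> \<mu>"
  then obtain g where g: "g \<in> carrier_mat 1 n" and nz: "g \<noteq> 0\<^sub>m 1 n"
    and gX: "g * X = \<alpha> \<cdot>\<^sub>m g" and gY: "g * Y = \<mu> \<cdot>\<^sub>m g"
    using assms(7) unfolding corresponding_eigenvalues_def by auto
  note carriers = assms(1-8)
  let ?M = "\<alpha>^2 \<cdot>\<^sub>m A + \<mu>^2 \<cdot>\<^sub>m B + (\<alpha> * \<mu>) \<cdot>\<^sub>m C + \<alpha> \<cdot>\<^sub>m D + \<mu> \<cdot>\<^sub>m E + F"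
  have distrib: "g * (P + Q) = g * P + g * Q"
    if "P \<in> carrier_mat n n" "Q \<in> carrier_mat n n" for P Q
    using mult_add_distrib_mat[OF g that] .
  have sq: "Z ^\<^sub>m 2 = Z * Z" if "Z \<in> carrier_mat n n" for Z :: "complex mat"
    using that by (simp add: numeral_2_eq_2)
  have prods: "P * Q \<in> carrier_mat n n"
    if "P \<in> carrier_mat n n" "Q \<in> carrier_mat n n" for P Q :: "complex mat"
    using that by simp
  have terms: "g * (X * X * A) = g * (\<alpha>^2 \<cdot>\<^sub>m A)" "g * (Y * Y * B) = g * (\<mu>^2 \<cdot>\<^sub>m B)"
    "g * (X * Y * C) = g * ((\<alpha> * \<mu>) \<cdot>\<^sub>m C)" "g * (X * D) = g * (\<alpha> \<cdot>\<^sub>m D)"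
    "g * (Y * E) = g * (\<mu> \<cdot>\<^sub>m E)"
    using left_eigenvector_mult_mult[OF g assms(7,7,1) gX gX]
      left_eigenvector_mult_mult[OF g assms(8,8,2) gY gY]
      left_eigenvector_mult_mult[OF g assms(7,8,3) gX gY]
      left_eigenvector_mult[OF g assms(7,4) gX] left_eigenvector_mult[OF g assms(8,5) gY]
    by (simp_all only: power2_eq_square)
  \<comment> \<open>Associativity as a rewrite rule would bracket the products to the right, out of reach of \<open>terms\<close>.\<close>
  have "g * ?M = g * (X * X * A + Y * Y * B + X * Y * C + X * D + Y * E + F)"
    using carriers by (simp add: distrib terms prods del: assoc_mult_mat)
  also have "\<dots> = 0\<^sub>m 1 n"
    using assms(9) g by (simp add: sq[OF assms(7)] sq[OF assms(8)])
  finally have "g * ?M = 0\<^sub>m 1 n" .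
  moreover have "?M \<in> carrier_mat n n"
    using carriers by simp
  ultimately show "det ?M = 0"
    using det_zero_of_left_kernel[OF _ g nz] by blast
qed

end
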